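(* For $n\ge 3$, the Kneser graph $K(n,2)$ satisfies $\mathrm{gp}^-(K(n,2))=3$ if $n\in\{3,6,7\}$; $=4$ if $n\in\{5,8,9\}$; $=5$ if $n\in\{10,11\}$; and $=6$ otherwise.
   Context: $K(n,2)$ has as vertices the 2-element subsets of $\{1,\dots,n\}$, two being adjacent iff disjoint. A set $S$ of vertices of a graph $G$ is a general position set if no shortest path contains three or more vertices of $S$; it is maximal if not properly contained in another general position set; $\mathrm{gp}^-(G)$ is the number of vertices in a smallest maximal general position set. *)

theory Defs
  imports "Graph_Theory.Pair_Digraph" "Graph_Theory.Vertex_Walk"
begin

text \<open>Undirected graphs are symmetric loop-free digraphs; paths are lists of vertices.\<close>

definition kneser_graph :: "nat \<Rightarrow> nat \<Rightarrow> nat set pair_pre_digraph" where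
  "kneser_graph n k =
    \<lparr> pverts = {A. A \<subseteq> {1..n} \<and> card A = k},
      parcs = {(A, B). A \<subseteq> {1..n} \<and> card A = k \<and> B \<subseteq> {1..n} \<and> card B = k \<and> A \<inter> B = {}} \<rparr>"

lemma pair_graph_kneser_graph:
  assumes "k > 0"
  shows "pair_graph (kneser_graph n k)"
proof -
  have fin: "finite {A. A \<subseteq> {1..n} \<and> card A = k}"
    by (rule finite_subset[of _ "Pow {1..n}"]) auto
  have "finite (parcs (kneser_graph n k))"
    by (rule finite_subset[OF _ finite_cartesian_product[OF fin fin]])
      (auto simp: kneser_graph_def)
  moreover have "finite (pverts (kneser_graph n k))"
    using fin by (simp add: kneser_graph_def)
  moreover have "symmetric (kneser_graph n k)"
    unfolding symmetric_def sym_def by (simp add: kneser_graph_def Int_commute)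
  moreover have "fst e \<noteq> snd e \<and> fst e \<in> pverts (kneser_graph n k) \<and>
      snd e \<in> pverts (kneser_graph n k)" if e: "e \<in> parcs (kneser_graph n k)" for e
  proof (cases e)
    case (Pair A B)
    have *: "A \<subseteq> {1..n}" "card A = k" "B \<subseteq> {1..n}" "card B = k" "A \<inter> B = {}"
      using e unfolding Pair kneser_graph_def by simp_all
    have "A \<noteq> B"
    proof
      assume "A = B"
      then have "A = {}" using *(5) by simp
      then show False using *(2) assms by simp
    qed
    then show ?thesis
      unfolding Pair kneser_graph_def using * by simp
  qed
  ultimately show ?thesis
    by unfold_locales simp_all
qed

definition shortest_path :: "('a, 'b) pre_digraph \<Rightarrow> 'a list \<Rightarrow> bool" where
  "shortest_path G p \<longleftrightarrow> vpath p G \<and>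
    (\<forall>q. vpath q G \<and> hd q = hd p \<and> last q = last p \<longrightarrow> vwalk_length p \<le> vwalk_length q)"

definition general_position_set :: "('a, 'b) pre_digraph \<Rightarrow> 'a set \<Rightarrow> bool" where
  "general_position_set G S \<longleftrightarrow> S \<subseteq> verts G \<and>
    \<not> (\<exists>p. shortest_path G p \<and> card (set p \<inter> S) \<ge> 3)"

definition maximal_general_position_set :: "('a, 'b) pre_digraph \<Rightarrow> 'a set \<Rightarrow> bool" where
  "maximal_general_position_set G S \<longleftrightarrow> general_position_set G S \<and>
    \<not> (\<exists>T. general_position_set G T \<and> S \<subset> T)"

text \<open>Meant for finite graphs, where a maximal general position set always exists.\<close>

definition gp_minus :: "('a, 'b) pre_digraph \<Rightarrow> nat" where
  "gp_minus G = (LEAST m. \<exists>S. maximal_general_position_set G S \<and> card S = m)"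

end

theory Submission
  imports Defs
begin

text \<open>
  For \<open>n \<ge> 5\<close> the graph has diameter 2, so a vertex set is in general position iff disjointness
  is transitive on it. A family of pairs with this property consists of pairs of a fixed 4-set,
  or of pairs through a fixed point, or is a matching. Hence the maximal ones are the six pairs of
  a 4-set, the stars with \<open>n - 1\<close> pairs, and, if \<open>n \<ge> 6\<close>, the matchings with \<open>n div 2\<close> edges. For
  \<open>n \<le> 4\<close> all vertices together are in general position.
\<close>

section \<open>Pairs and transitivity of disjointness\<close>

definition pairs :: "'a set \<Rightarrow> 'a set set" where
  "pairs A = {e. e \<subseteq> A \<and> card e = 2}"

text \<open>Equivalently, "equal or disjoint" is an equivalence relation on \<open>S\<close>; this
  is why the case \<open>a = c\<close> is exempt.\<close>

definition disjoint_transitive :: "'a set set \<Rightarrow> bool" where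
  "disjoint_transitive S \<longleftrightarrow>
    (\<forall>a\<in>S. \<forall>b\<in>S. \<forall>c\<in>S. a \<inter> b = {} \<longrightarrow> b \<inter> c = {} \<longrightarrow> a \<noteq> c \<longrightarrow> a \<inter> c = {})"

lemma disjoint_transitiveD:
  assumes "disjoint_transitive S" "a \<in> S" "b \<in> S" "c \<in> S"
    and "a \<inter> b = {}" "b \<inter> c = {}" "a \<noteq> c"
  shows "a \<inter> c = {}"
  using assms unfolding disjoint_transitive_def by blast

lemma finite_pairs: "finite A \<Longrightarrow> finite (pairs A)"
  unfolding pairs_def by simp

lemma card_pairs: "finite A \<Longrightarrow> card (pairs A) = card A choose 2"
  unfolding pairs_def by (rule n_subsets)

lemma pairs_finite: "e \<in> pairs A \<Longrightarrow> finite e"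
  unfolding pairs_def by (auto intro: card_ge_0_finite)

lemma card_union_disjoint_pairs:
  assumes "a \<in> pairs A" "b \<in> pairs A" "a \<inter> b = {}"
  shows "card (a \<union> b) = 4"
  using assms pairs_finite[of a A] pairs_finite[of b A]
  by (simp add: card_Un_disjoint pairs_def)

text \<open>Both \<open>a\<close> and \<open>c\<close> are pairs inside \<open>Q - b\<close>, which
  has at most two points, so each equals \<open>Q - b\<close>.\<close>

lemma complement_unique_in_four_set:
  assumes "finite Q" "card Q \<le> 4" "a \<in> pairs Q" "b \<in> pairs Q" "c \<in> pairs Q"
    and "a \<inter> b = {}" "b \<inter> c = {}"
  shows "a = c"
proof -
  have "card (Q - b) \<le> 2"
    using assms card_Diff_subset[of b Q] pairs_finite[of b Q] by (simp add: pairs_def)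
  moreover have "a \<subseteq> Q - b" "c \<subseteq> Q - b" "card a = 2" "card c = 2"
    using assms by (auto simp: pairs_def)
  ultimately show ?thesis
    by (metis assms(1) card_seteq finite_Diff)
qed

lemma disjoint_transitive_pairs:
  assumes "finite Q" "card Q \<le> 4"
  shows "disjoint_transitive (pairs Q)"
  unfolding disjoint_transitive_def using complement_unique_in_four_set[OF assms] by blast

section \<open>Classification of the families with transitive disjointness\<close>

lemma meets_both_subset_union:
  assumes "h \<in> pairs A" "h \<inter> e \<noteq> {}" "h \<inter> f \<noteq> {}" "e \<inter> f = {}"
  shows "h \<subseteq> e \<union> f"
proof -
  \<comment> \<open>As \<open>e\<close> and \<open>f\<close> are disjoint, one point of
    \<open>h\<close> lies in \<open>e\<close> and the other in \<open>f\<close>.\<close>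
  obtain x y where "h = {x, y}"
    using assms(1) by (auto simp: pairs_def card_2_iff)
  then show ?thesis using assms(2-4) by auto
qed

text \<open>An intersecting family of edges is a star or lies in a triangle. If no point is common
  to all, take a member \<open>{a, b}\<close>, one that avoids \<open>a\<close> and one that avoids
  \<open>b\<close>: meeting each other, they are \<open>{b, c}\<close> and \<open>{a, c}\<close>. A
  pair that meets all three sides of a triangle is itself a side.\<close>

lemma intersecting_pairs_cases:
  assumes S: "S \<subseteq> pairs A" and int: "\<And>e f. e \<in> S \<Longrightarrow> f \<in> S \<Longrightarrow> e \<inter> f \<noteq> {}" and "S \<noteq> {}"
  obtains x where "x \<in> A" "\<And>e. e \<in> S \<Longrightarrow> x \<in> e" | T where "T \<subseteq> A" "card T = 3" "S \<subseteq> pairs T"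
proof (cases "\<exists>x\<in>A. \<forall>e\<in>S. x \<in> e")
  case True
  then show thesis using that(1) by blast
next
  case False
  obtain g where g: "g \<in> S" using assms(3) by blast
  then obtain a b where ab: "g = {a, b}" "a \<noteq> b" "a \<in> A" "b \<in> A"
    using S by (auto simp: pairs_def card_2_iff)
  obtain h where h: "h \<in> S" "a \<notin> h" using False ab by blast
  then obtain c where c: "h = {b, c}" "c \<noteq> b" "c \<in> A" "c \<noteq> a"
    using S int[OF g h(1)] ab(1) by (auto simp: pairs_def card_2_iff insert_commute)
  obtain k where k: "k \<in> S" "b \<notin> k" using False ab by blast
  then have k_eq: "k = {a, c}"
    using S int[OF g k(1)] int[OF h(1) k(1)] ab c
    by (auto simp: pairs_def card_2_iff insert_commute)
  have "e \<in> pairs {a, b, c}" if "e \<in> S" for e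
    using S that int[OF that g] int[OF that h(1)] int[OF that k(1)] ab c k_eq
    by (auto simp: pairs_def card_2_iff insert_commute)
  then show thesis using that(2)[of "{a, b, c}"] ab c by auto
qed

text \<open>An intersecting family is a star or lies in a triangle. Otherwise fix disjoint members
  \<open>e\<close> and \<open>f\<close>: a member that meets both confines the family to
  \<open>e \<union> f\<close>, and without such a member the family is a matching.\<close>

lemma disjoint_transitive_cases:
  assumes S: "S \<subseteq> pairs A" and dt: "disjoint_transitive S"
    and A: "finite A" "card A \<ge> 4"
  obtains (star) x where "x \<in> A" "\<And>e. e \<in> S \<Longrightarrow> x \<in> e"
    | (four) Q where "Q \<subseteq> A" "card Q = 4" "S \<subseteq> pairs Q"
    | (matching) "card S \<ge> 3" "pairwise disjnt S"
proof (cases "\<forall>e\<in>S. \<forall>f\<in>S. e \<inter> f \<noteq> {}")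
  case True
  show thesis
  proof (cases "S = {}")
    case True
    have "A \<noteq> {}" using A by auto
    then show ?thesis using star True by blast
  next
    case False
    show ?thesis
    proof (rule intersecting_pairs_cases[OF S _ False])
      fix T assume T: "T \<subseteq> A" "card T = 3" "S \<subseteq> pairs T"
      have "finite T" using T A finite_subset by blast
      \<comment> \<open>A further point of \<open>A\<close> enlarges the triangle to a
        4-set.\<close>
      have "\<not> A \<subseteq> T" using T A card_mono[OF \<open>finite T\<close>, of A] by auto
      then obtain x where x: "x \<in> A" "x \<notin> T" by blast
      have "S \<subseteq> pairs (insert x T)" using T(3) by (auto simp: pairs_def)
      then show ?thesis using four[of "insert x T"] x T \<open>finite T\<close> by simp
    qed (use True star in blast)+
  qed
next
  case False
  then obtain e f where ef: "e \<in> S" "f \<in> S" "e \<inter> f = {}" by blast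
  have Q: "e \<union> f \<subseteq> A" "card (e \<union> f) = 4"
    using ef S card_union_disjoint_pairs[of e A f] by (auto simp: pairs_def)
  have "e \<noteq> {}" "f \<noteq> {}" using ef S by (auto simp: pairs_def)
  show thesis
  proof (cases "\<exists>g\<in>S. g \<inter> e \<noteq> {} \<and> g \<inter> f \<noteq> {}")
    case True
    then obtain g where g: "g \<in> S" "g \<inter> e \<noteq> {}" "g \<inter> f \<noteq> {}" by blast
    then have g_sub: "g \<subseteq> e \<union> f" using S ef meets_both_subset_union by blast
    \<comment> \<open>A member \<open>h\<close> that leaves \<open>e \<union> f\<close> misses
      \<open>e\<close> or \<open>f\<close>, hence both by transitivity. It then misses
      \<open>g\<close>, and transitivity along \<open>g\<close>, \<open>h\<close>, \<open>e\<close>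
      makes \<open>g\<close> disjoint from \<open>e\<close>.\<close>
    have "h \<subseteq> e \<union> f" if h: "h \<in> S" for h
    proof (rule ccontr)
      assume n: "\<not> h \<subseteq> e \<union> f"
      then have "h \<inter> e = {} \<or> h \<inter> f = {}" "h \<noteq> e" "h \<noteq> f"
        using meets_both_subset_union h S ef by blast+
      then have "h \<inter> e = {}" "h \<inter> f = {}"
        using disjoint_transitiveD[OF dt h ef(1,2)] disjoint_transitiveD[OF dt h ef(2,1)] ef(3)
        by blast+
      moreover have "g \<noteq> e" using g ef by blast
      ultimately have "g \<inter> e = {}"
        using disjoint_transitiveD[OF dt g(1) h ef(1)] g_sub by blast
      then show False using g by blast
    qed
    then have "S \<subseteq> pairs (e \<union> f)" using S by (auto simp: pairs_def)
    then show ?thesis using four Q by blast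
  next
    case False
    \<comment> \<open>By assumption \<open>h\<close> misses \<open>e\<close> or \<open>f\<close>; if
      it misses \<open>f\<close>, transitivity along \<open>h\<close>, \<open>f\<close>,
      \<open>e\<close> applies. Then \<open>e\<close> is the middle term that separates any two
      other members.\<close>
    have e_disj: "h \<inter> e = {}" if h: "h \<in> S" "h \<noteq> e" for h
      using False h ef disjoint_transitiveD[OF dt h(1) ef(2,1)] by blast
    have "h \<inter> k = {}" if "h \<in> S" "k \<in> S" "h \<noteq> k" for h k
      using disjoint_transitiveD[OF dt that(1) ef(1) that(2)] e_disj that by blast
    then have disj: "pairwise disjnt S" by (auto simp: pairwise_def disjnt_def)
    have fin: "finite S" using S finite_pairs[OF A(1)] finite_subset by blast
    show ?thesis
    \<comment> \<open>A matching of only two edges counts as a family inside a 4-set, so the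
      matching case starts at three edges.\<close>
    proof (cases "S \<subseteq> {e, f}")
      case True
      then have "S \<subseteq> pairs (e \<union> f)" using S by (auto simp: pairs_def)
      then show ?thesis using four Q by blast
    next
      case F: False
      then obtain h where "h \<in> S" "h \<noteq> e" "h \<noteq> f" by blast
      moreover have "e \<noteq> f" using ef(3) \<open>e \<noteq> {}\<close> by blast
      ultimately have "{e, f, h} \<subseteq> S" "card {e, f, h} = 3" using ef by simp_all
      then have "card S \<ge> 3" using card_mono[OF fin] by metis
      then show ?thesis using matching disj by blast
    qed
  qed
qed

section \<open>Sizes of matchings and stars\<close>

lemma card_pairwise_disjoint_pairs:
  assumes "S \<subseteq> pairs A" "finite A" "pairwise disjnt S"
  shows "card (\<Union>S) = 2 * card S"
proof -
  have "card (\<Union>S) = sum card S"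
    using assms by (intro card_Union_disjoint) (auto intro: pairs_finite)
  also have "\<dots> = (\<Sum>e\<in>S. 2)" using assms(1) by (intro sum.cong) (auto simp: pairs_def)
  finally show ?thesis by simp
qed

lemma disjoint_transitive_pairwise_disjnt: "pairwise disjnt S \<Longrightarrow> disjoint_transitive S"
  by (auto simp: disjoint_transitive_def pairwise_def disjnt_def)

lemma disjoint_transitive_star: "disjoint_transitive {e \<in> pairs A. x \<in> e}"
  by (auto simp: disjoint_transitive_def)

lemma card_star:
  assumes "finite A" "x \<in> A"
  shows "card {e \<in> pairs A. x \<in> e} = card A - 1"
proof -
  have "{e \<in> pairs A. x \<in> e} = (\<lambda>y. {x, y}) ` (A - {x})"
    using assms(2) by (auto simp: pairs_def card_2_iff image_def insert_commute)
  moreover have "inj_on (\<lambda>y. {x, y}) (A - {x})"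
    by (auto simp: inj_on_def doubleton_eq_iff)
  ultimately show ?thesis using assms by (simp add: card_image)
qed

section \<open>Maximal families: their possible sizes, and the three kinds of examples\<close>

definition maximal_disjoint_transitive :: "'a set \<Rightarrow> 'a set set \<Rightarrow> bool" where
  "maximal_disjoint_transitive A S \<longleftrightarrow> S \<subseteq> pairs A \<and> disjoint_transitive S \<and>
    (\<forall>T. T \<subseteq> pairs A \<longrightarrow> disjoint_transitive T \<longrightarrow> S \<subseteq> T \<longrightarrow> T = S)"

lemma maximal_disjoint_transitiveI:
  assumes "S \<subseteq> pairs A" "disjoint_transitive S"
    and "\<And>T e. T \<subseteq> pairs A \<Longrightarrow> disjoint_transitive T \<Longrightarrow> S \<subseteq> T \<Longrightarrow> e \<in> T \<Longrightarrow> e \<notin> S \<Longrightarrow> False"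
  shows "maximal_disjoint_transitive A S"
  unfolding maximal_disjoint_transitive_def using assms by blast

text \<open>By maximality, a family inside a 4-set or a star is all of it. A maximal matching leaves
  at most one point uncovered, and its three or more edges require six points.\<close>

lemma maximal_disjoint_transitive_card_ge:
  assumes A: "finite A" "card A \<ge> 5" and max: "maximal_disjoint_transitive A S"
  shows "card S = 6 \<or> card S = card A - 1 \<or> card A \<ge> 6 \<and> card S \<ge> card A div 2"
proof -
  have S: "S \<subseteq> pairs A" "disjoint_transitive S"
    using max by (auto simp: maximal_disjoint_transitive_def)
  have eq: "T = S" if "T \<subseteq> pairs A" "disjoint_transitive T" "S \<subseteq> T" for T
    using max that by (auto simp: maximal_disjoint_transitive_def)
  have "card A \<ge> 4" using A by simp
  from S A(1) this show ?thesis
  proof (cases rule: disjoint_transitive_cases)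
    case (star x)
    have "{e \<in> pairs A. x \<in> e} = S"
      using S star by (intro eq disjoint_transitive_star) auto
    then show ?thesis using card_star[OF A(1) star(1)] by simp
  next
    case (four Q)
    have Q: "finite Q" using four by (simp add: card_ge_0_finite)
    have "pairs Q = S"
      using four Q by (intro eq disjoint_transitive_pairs) (auto simp: pairs_def)
    then show ?thesis using card_pairs[OF Q] four by (auto simp: choose_two)
  next
    case matching
    have sub: "\<Union>S \<subseteq> A" using S by (auto simp: pairs_def)
    have cardU: "card (\<Union>S) = 2 * card S"
      by (rule card_pairwise_disjoint_pairs[OF S(1) A(1) matching(2)])
    have "2 * card S \<le> card A" using card_mono[OF A(1) sub] cardU by simp
    \<comment> \<open>Two uncovered points would form an edge that extends the matching.\<close>
    moreover have "card (A - \<Union>S) < 2"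
    proof (rule ccontr)
      assume "\<not> ?thesis"
      then obtain e where e: "e \<subseteq> A - \<Union>S" "card e = 2"
        by (meson leI obtain_subset_with_card_n)
      have "insert e S = S"
      proof (intro eq disjoint_transitive_pairwise_disjnt)
        show "pairwise disjnt (insert e S)"
          using e matching(2) by (force simp: pairwise_insert disjnt_def)
      qed (use e S in \<open>auto simp: pairs_def\<close>)
      then have "e \<subseteq> \<Union>S" by blast
      then have "e = {}" using e by blast
      then show False using e by simp
    qed
    then have "card A < 2 * card S + 2"
      using card_Diff_subset[OF finite_subset[OF sub A(1)] sub] cardU by simp
    ultimately show ?thesis using matching by auto
  qed
qed

text \<open>A new pair \<open>e\<close> has at most one point in \<open>Q\<close>, so it misses
  three points \<open>x\<close>, \<open>y\<close>, \<open>z\<close> of \<open>Q\<close>. It is then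
  disjoint from \<open>{x, y}\<close> and \<open>{x, z}\<close>, which meet in
  \<open>x\<close>.\<close>

lemma maximal_disjoint_transitive_four_set:
  assumes "finite A" "Q \<subseteq> A" "card Q = 4"
  shows "maximal_disjoint_transitive A (pairs Q)"
proof (rule maximal_disjoint_transitiveI)
  have Q: "finite Q" using assms finite_subset by blast
  show "pairs Q \<subseteq> pairs A" using assms by (auto simp: pairs_def)
  show "disjoint_transitive (pairs Q)" using Q assms by (simp add: disjoint_transitive_pairs)
  fix T e
  assume T: "T \<subseteq> pairs A" "disjoint_transitive T" "pairs Q \<subseteq> T" "e \<in> T" "e \<notin> pairs Q"
  have e: "card e = 2" "finite e" using T pairs_finite by (auto simp: pairs_def)
  have "\<not> e \<subseteq> Q" using T(5) e by (simp add: pairs_def)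
  then have "Q \<inter> e \<subset> e" by blast
  then have "card (Q \<inter> e) < 2" using psubset_card_mono e by metis
  then have "card (Q - e) \<ge> 3" using card_Diff_subset_Int[of Q e] Q assms by simp
  then obtain R where R: "R \<subseteq> Q - e" "card R = 3" by (meson obtain_subset_with_card_n)
  then obtain x y z where xyz: "R = {x, y, z}" "x \<noteq> y" "x \<noteq> z" "y \<noteq> z"
    by (auto simp: card_3_iff)
  then have "{x, y} \<in> T" "{x, z} \<in> T" using T(3) R by (auto simp: pairs_def)
  moreover have "{x, y} \<inter> e = {}" "e \<inter> {x, z} = {}" using R xyz by auto
  ultimately have "{x, y} \<inter> {x, z} = {}"
    using disjoint_transitiveD[OF T(2) _ T(4), of "{x, y}" "{x, z}"] xyz
    by (auto simp: doubleton_eq_iff)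
  then show False by blast
qed

text \<open>A new pair \<open>e\<close> avoids \<open>x\<close>. Among five points, two points
  \<open>y\<close> and \<open>z\<close> remain beside \<open>x\<close> and \<open>e\<close>, and
  \<open>e\<close> is disjoint from the meeting pairs \<open>{x, y}\<close> and
  \<open>{x, z}\<close>.\<close>

lemma maximal_disjoint_transitive_star:
  assumes "finite A" "card A \<ge> 5" "x \<in> A"
  shows "maximal_disjoint_transitive A {e \<in> pairs A. x \<in> e}"
proof (rule maximal_disjoint_transitiveI[OF _ disjoint_transitive_star])
  fix T e
  assume T: "T \<subseteq> pairs A" "disjoint_transitive T" "{e \<in> pairs A. x \<in> e} \<subseteq> T"
    and e: "e \<in> T" "e \<notin> {e \<in> pairs A. x \<in> e}"
  have "e \<in> pairs A" using T e by blast
  then have e': "card e = 2" "finite e" "e \<subseteq> A" "x \<notin> e"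
    using e(2) pairs_finite[of e A] by (simp_all add: pairs_def)
  have "card (A - insert x e) \<ge> 2" using assms e' by (subst card_Diff_subset) auto
  then obtain R where R: "R \<subseteq> A - insert x e" "card R = 2" by (meson obtain_subset_with_card_n)
  then obtain y z where yz: "R = {y, z}" "y \<noteq> z" by (auto simp: card_2_iff)
  then have "{x, y} \<in> {e \<in> pairs A. x \<in> e}" "{x, z} \<in> {e \<in> pairs A. x \<in> e}"
    using R assms(3) by (auto simp: pairs_def)
  then have "{x, y} \<in> T" "{x, z} \<in> T" using T(3) by blast+
  moreover have "{x, y} \<inter> e = {}" "e \<inter> {x, z} = {}" using R yz e' by auto
  ultimately have "{x, y} \<inter> {x, z} = {}"
    using disjoint_transitiveD[OF T(2) _ e(1), of "{x, y}" "{x, z}"] yz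
    by (auto simp: doubleton_eq_iff)
  then show False by blast
qed auto

text \<open>A new pair \<open>e\<close> meets at most two of the three or more edges, so it misses
  some \<open>f\<close>. At most one point is uncovered, so \<open>e\<close> meets some edge
  \<open>g\<close>. Then \<open>g\<close>, \<open>f\<close>, \<open>e\<close> violate
  transitivity.\<close>

lemma maximal_disjoint_transitive_matching:
  assumes "finite A" "S \<subseteq> pairs A" "pairwise disjnt S" "card S \<ge> 3" "card A \<le> 2 * card S + 1"
  shows "maximal_disjoint_transitive A S"
proof (rule maximal_disjoint_transitiveI
    [OF assms(2) disjoint_transitive_pairwise_disjnt[OF assms(3)]])
  fix T e
  assume T: "T \<subseteq> pairs A" "disjoint_transitive T" "S \<subseteq> T" and e: "e \<in> T" "e \<notin> S"
  have "e \<in> pairs A" using T e by blast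
  then have e': "card e = 2" "finite e" "e \<subseteq> A"
    using pairs_finite[of e A] by (simp_all add: pairs_def)
  have fin: "finite S" using assms finite_pairs finite_subset by blast
  obtain x y where xy: "e = {x, y}" using e' by (auto simp: card_2_iff)
  have "\<exists>f\<in>S. f \<inter> e = {}"
  proof (rule ccontr)
    assume "\<not> ?thesis"
    then have "S \<subseteq> {f \<in> S. x \<in> f} \<union> {f \<in> S. y \<in> f}" using xy by auto
    then have "card S \<le> card ({f \<in> S. x \<in> f} \<union> {f \<in> S. y \<in> f})"
      using fin by (intro card_mono) auto
    also have "\<dots> \<le> card {f \<in> S. x \<in> f} + card {f \<in> S. y \<in> f}" by (rule card_Un_le)
    \<comment> \<open>At most one edge of a matching passes through a given point.\<close>
    also have "card {f \<in> S. z \<in> f} \<le> 1" for z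
      using assms(3) fin by (auto simp: card_le_Suc0_iff_eq pairwise_def disjnt_def)
    then have "card {f \<in> S. x \<in> f} + card {f \<in> S. y \<in> f} \<le> 1 + 1" by (meson add_mono)
    finally show False using assms by simp
  qed
  then obtain f where f: "f \<in> S" "f \<inter> e = {}" by blast
  have sub: "\<Union>S \<subseteq> A" using assms by (auto simp: pairs_def)
  have "\<not> e \<subseteq> A - \<Union>S"
  proof
    assume "e \<subseteq> A - \<Union>S"
    then have "card e \<le> card (A - \<Union>S)" using assms by (intro card_mono) auto
    also have "\<dots> = card A - 2 * card S"
      using card_Diff_subset[OF finite_subset[OF sub assms(1)] sub]
        card_pairwise_disjoint_pairs[OF assms(2,1,3)] by simp
    finally show False using e' assms by simp
  qed
  then obtain g where g: "g \<in> S" "g \<inter> e \<noteq> {}" using e' by blast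
  have "g \<inter> f = {}" using f g assms(3) by (auto simp: pairwise_def disjnt_def)
  then have "g \<inter> e = {}"
    using disjoint_transitiveD[OF T(2), of g f e] f g e T(3) by blast
  then show False using g by blast
qed

lemma ex_matching:
  obtains S where "S \<subseteq> pairs {1..n::nat}" "pairwise disjnt S" "card S = n div 2"
proof
  \<comment> \<open>The edges are \<open>{1, 2}\<close>, \<open>{3, 4}\<close> and so on; for odd
    \<open>n\<close> the point \<open>n\<close> stays uncovered.\<close>
  let ?p = "\<lambda>i. {2 * i + 1, 2 * i + 2 :: nat}"
  have "inj_on ?p {..<n div 2}"
    by (auto simp: inj_on_def doubleton_eq_iff)
  then show "card (?p ` {..<n div 2}) = n div 2" by (simp add: card_image)
  show "pairwise disjnt (?p ` {..<n div 2})"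
    by (auto simp: pairwise_def disjnt_def) presburger+
  show "?p ` {..<n div 2} \<subseteq> pairs {1..n}" by (auto simp: pairs_def)
qed

section \<open>General position in the Kneser graph\<close>

lemma verts_kneser: "verts (with_proj (kneser_graph n 2)) = pairs {1..n}"
  by (simp add: kneser_graph_def pairs_def)

lemma arc_kneser:
  "(a, b) \<in> arcs_ends (with_proj (kneser_graph n 2)) \<longleftrightarrow>
    a \<in> pairs {1..n} \<and> b \<in> pairs {1..n} \<and> a \<inter> b = {}"
  by (auto simp: kneser_graph_def pairs_def arcs_ends_def arc_to_ends_def)

text \<open>A path with three vertices in \<open>S\<close> has at least three entries. Paths repeat
  no vertex, so the ends of its first two arcs differ.\<close>

lemma vpath_triple:
  assumes "vpath p G" "card (set p \<inter> S) \<ge> 3"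
  obtains a b c q where "p = a # b # c # q" "(a, b) \<in> arcs_ends G" "(b, c) \<in> arcs_ends G" "a \<noteq> c"
proof -
  have "3 \<le> length p"
    using assms(2) card_mono[of "set p" "set p \<inter> S"] card_length[of p] by simp
  then obtain a b c q where "p = a # b # c # q"
    by (auto simp: numeral_3_eq_3 Suc_le_length_iff)
  then show thesis using that assms(1) by (auto simp: vpath_def vwalk_def)
qed

text \<open>For \<open>n \<le> 4\<close> a vertex has at most one neighbour, its complement, so no
  path has three vertices.\<close>

lemma general_position_small:
  assumes "n \<le> 4"
  shows "general_position_set (kneser_graph n 2) S \<longleftrightarrow> S \<subseteq> pairs {1..n}"
proof -
  have False if "vpath p (kneser_graph n 2)" "card (set p \<inter> S) \<ge> 3" for p
    using vpath_triple[OF that] arc_kneser[of _ _ n] assms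
      complement_unique_in_four_set[of "{1..n}"]
    by (metis card_atLeastAtMost diff_Suc_1 finite_atLeastAtMost)
  then show ?thesis
    unfolding general_position_set_def shortest_path_def verts_kneser by blast
qed

lemma gp_minus_small:
  assumes "n \<le> 4"
  shows "gp_minus (kneser_graph n 2) = n choose 2"
proof -
  have "maximal_general_position_set (kneser_graph n 2) S \<longleftrightarrow> S = pairs {1..n}" for S
    unfolding maximal_general_position_set_def general_position_small[OF assms] by blast
  then show ?thesis
    unfolding gp_minus_def by (auto simp: card_pairs intro: Least_equality)
qed

text \<open>The diameter is at most 2: two meeting pairs cover at most three of the five or more
  points, which leaves a pair disjoint from both.\<close>

lemma short_path_kneser:
  assumes n: "n \<ge> 5" and "a \<in> pairs {1..n}" "c \<in> pairs {1..n}"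
  obtains q where "vpath q (kneser_graph n 2)" "hd q = a" "last q = c" "length q \<le> 3"
proof (cases "a = c")
  case True
  then show thesis using that[of "[a]"] assms
    by (simp add: vpath_def vwalk_def verts_kneser del: with_proj_simps)
next
  case ac: False
  show thesis
  proof (cases "a \<inter> c = {}")
    case True
    then show thesis
      using that[of "[a, c]"] assms ac
      by (simp add: vpath_def vwalk_def verts_kneser arc_kneser del: with_proj_simps)
  next
    case False
    have fin: "finite a" "finite c" using assms pairs_finite by auto
    have "card (a \<inter> c) \<ge> 1" using False fin by (simp add: card_gt_0_iff Suc_le_eq)
    then have "card (a \<union> c) \<le> 3" using card_Un_Int[OF fin] assms by (simp add: pairs_def)
    then have "card ({1..n} - (a \<union> c)) \<ge> 2"
      using fin n assms by (subst card_Diff_subset) (auto simp: pairs_def)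
    then obtain b where b: "b \<subseteq> {1..n} - (a \<union> c)" "card b = 2"
      by (meson obtain_subset_with_card_n)
    then have "b \<in> pairs {1..n}" "a \<inter> b = {}" "b \<inter> c = {}" by (auto simp: pairs_def)
    moreover from this have "a \<noteq> b" "b \<noteq> c" using b False by auto
    ultimately show thesis
      using that[of "[a, b, c]"] assms ac
      by (simp add: vpath_def vwalk_def verts_kneser arc_kneser del: with_proj_simps)
  qed
qed

text \<open>A failure of transitivity at \<open>a\<close>, \<open>b\<close>, \<open>c\<close> is a
  shortest path, since its ends are distinct and not adjacent. Conversely, a shortest path through
  three members has just three vertices, and transitivity would join its ends by an arc.\<close>

lemma general_position_kneser:
  assumes n: "n \<ge> 5"
  shows "general_position_set (kneser_graph n 2) S \<longleftrightarrow> S \<subseteq> pairs {1..n} \<and> disjoint_transitive S"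
    (is "general_position_set ?G S \<longleftrightarrow> _")
proof (intro iffI conjI)
  assume gp: "general_position_set ?G S"
  show S: "S \<subseteq> pairs {1..n}"
    using gp by (simp only: general_position_set_def verts_kneser)
  show "disjoint_transitive S"
    unfolding disjoint_transitive_def
  proof (intro ballI impI, rule ccontr)
    fix a b c
    assume abc: "a \<in> S" "b \<in> S" "c \<in> S" "a \<inter> b = {}" "b \<inter> c = {}" "a \<noteq> c" "a \<inter> c \<noteq> {}"
    then have "a \<noteq> b" "b \<noteq> c" by auto
    then have path: "vpath [a, b, c] ?G"
      using abc S by (auto simp: vpath_def vwalk_def verts_kneser arc_kneser simp del: with_proj_simps)
    have "vwalk_length [a, b, c] \<le> vwalk_length q"
      if q: "vpath q ?G" "hd q = a" "last q = c" for q
    proof (cases q)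
      case (Cons x r)
      show ?thesis
      proof (cases r)
        case (Cons y s)
        \<comment> \<open>A walk with only two vertices would be an arc from \<open>a\<close> to
          \<open>c\<close>, but these meet.\<close>
        have "s \<noteq> []"
          using q abc \<open>q = x # r\<close> Cons
          by (auto simp: vpath_def vwalk_def arc_kneser simp del: with_proj_simps)
        then show ?thesis using Cons \<open>q = x # r\<close> by (cases s) (auto simp: vwalk_length_def)
      qed (use q abc Cons in auto)
    qed (use q in \<open>auto simp: vpath_def vwalk_def\<close>)
    then have "shortest_path ?G [a, b, c]"
      unfolding shortest_path_def using path by simp
    moreover have "card (set [a, b, c] \<inter> S) \<ge> 3"
      using abc \<open>a \<noteq> b\<close> \<open>b \<noteq> c\<close> by simp
    ultimately show False using gp unfolding general_position_set_def by blast
  qed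
next
  assume S: "S \<subseteq> pairs {1..n} \<and> disjoint_transitive S"
  have False if p: "shortest_path ?G p" "card (set p \<inter> S) \<ge> 3" for p
  proof -
    have path: "vpath p ?G"
      and short: "\<And>q. vpath q ?G \<Longrightarrow> hd q = hd p \<Longrightarrow> last q = last p \<Longrightarrow>
        vwalk_length p \<le> vwalk_length q"
      using p unfolding shortest_path_def by auto
    obtain a b c r where abc: "p = a # b # c # r"
      "(a, b) \<in> arcs_ends ?G" "(b, c) \<in> arcs_ends ?G" "a \<noteq> c"
      using vpath_triple[OF path p(2)] by blast
    have "set p \<subseteq> pairs {1..n}"
      using path by (simp add: vpath_def vwalk_def verts_kneser del: with_proj_simps)
    then have "hd p \<in> pairs {1..n}" "last p \<in> pairs {1..n}"
      using abc(1) by (auto simp: subset_iff)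
    then obtain q where q: "vpath q ?G" "hd q = hd p" "last q = last p" "length q \<le> 3"
      using short_path_kneser[OF n] by metis
    have "length p - 1 \<le> length q - 1" using short[OF q(1-3)] by simp
    then have "length r = 0" using q(4) abc(1) by (simp del: length_0_conv)
    then have p_eq: "p = [a, b, c]" using abc by simp
    \<comment> \<open>The path has three vertices, so three of them in \<open>S\<close> means all of
      them.\<close>
    have "card {a, b, c} \<le> 3" by (simp add: card_insert_if)
    then have "set p \<inter> S = set p"
      using p(2) p_eq by (intro card_seteq) auto
    then have "a \<in> S" "b \<in> S" "c \<in> S" using p_eq by auto
    then have "a \<inter> c = {}"
      using disjoint_transitiveD[of S a b c] S abc(2-4) unfolding arc_kneser by blast
    \<comment> \<open>This shortcut contradicts the minimality of \<open>p\<close>.\<close>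
    then have "vpath [a, c] ?G"
      using abc by (auto simp: vpath_def vwalk_def verts_kneser arc_kneser simp del: with_proj_simps)
    then show False using short[of "[a, c]"] p_eq by (simp add: vwalk_length_def)
  qed
  then show "general_position_set ?G S"
    unfolding general_position_set_def verts_kneser using S by blast
qed

lemma maximal_general_position_kneser:
  assumes "n \<ge> 5"
  shows "maximal_general_position_set (kneser_graph n 2) S \<longleftrightarrow>
    maximal_disjoint_transitive {1..n} S"
  unfolding maximal_general_position_set_def general_position_kneser[OF assms]
    maximal_disjoint_transitive_def by blast

section \<open>The minimum over the three kinds of maximal families\<close>

lemma gp_minus_eqI:
  assumes "n \<ge> 5" "maximal_disjoint_transitive {1..n} S" "card S = m"
    and "m \<le> 6" "m \<le> n - 1" "n \<ge> 6 \<Longrightarrow> m \<le> n div 2"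
  shows "gp_minus (kneser_graph n 2) = m"
  unfolding gp_minus_def maximal_general_position_kneser[OF assms(1)]
proof (rule Least_equality)
  \<comment> \<open>The bounds on \<open>m\<close> match the three alternatives for the size of a
    maximal family; matchings compete only from \<open>n = 6\<close> on.\<close>
  fix k assume "\<exists>S. maximal_disjoint_transitive {1..n} S \<and> card S = k"
  then show "m \<le> k"
    using maximal_disjoint_transitive_card_ge[of "{1..n}"] assms by force
qed (use assms in blast)

theorem theorem5p1:
  fixes n :: nat
  assumes "n \<ge> 3"
  shows "gp_minus (kneser_graph n 2) =
    (if n \<in> {3, 6, 7} then 3
     else if n \<in> {5, 8, 9} then 4
     else if n \<in> {10, 11} then 5
     else 6)"
proof -
  consider "n = 3" | "n = 4" | "n = 5" | "6 \<le> n" "n \<le> 11" | "n \<ge> 12"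
    using assms by linarith
  then show ?thesis
  proof cases
    case 3
    \<comment> \<open>On five points the star has 4 pairs and beats the 6 pairs of a 4-set; three
      disjoint pairs do not fit.\<close>
    have "gp_minus (kneser_graph n 2) = 4"
      using 3 maximal_disjoint_transitive_star[of "{1..n}" 1] card_star[of "{1..n}" 1]
      by (intro gp_minus_eqI) auto
    then show ?thesis using 3 by simp
  next
    case 4
    \<comment> \<open>In this range \<open>n div 2\<close> is 3, 4 or 5, so matchings are
      smallest.\<close>
    obtain S where S: "S \<subseteq> pairs {1..n}" "pairwise disjnt S" "card S = n div 2"
      using ex_matching .
    have "maximal_disjoint_transitive {1..n} S"
      using S 4 by (intro maximal_disjoint_transitive_matching) auto
    then have "gp_minus (kneser_graph n 2) = n div 2"
      using S 4 by (intro gp_minus_eqI) auto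
    moreover have "n \<in> {6, 7, 8, 9, 10, 11}" using 4 by auto
    ultimately show ?thesis by auto
  next
    case 5
    \<comment> \<open>From \<open>n = 12\<close> on, matchings have at least 6 edges and stars at
      least 11, so a 4-set attains the minimum.\<close>
    have "maximal_disjoint_transitive {1..n} (pairs {1..4})"
      using 5 by (intro maximal_disjoint_transitive_four_set) auto
    then have "gp_minus (kneser_graph n 2) = 6"
      using 5 by (intro gp_minus_eqI) (auto simp: card_pairs choose_two)
    then show ?thesis using 5 by auto
  \<comment> \<open>For \<open>n = 3\<close> and \<open>n = 4\<close> all 3 or 6 vertices form the
    only maximal set.\<close>
  qed (simp_all add: gp_minus_small choose_two)
qed

end
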